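(* Let $0<\alpha\le1$ and $1\le p<\infty$. The space $W_{\Delta,a^+}^{\alpha,p}$ is separable with respect to the norm $\|\cdot\|_{W_{\Delta,a^+}^{\alpha,p}}$ given by $\|u\|_{W_{\Delta,a^+}^{\alpha,p}}^p=\|u\|_{L_\Delta^p}^p+\|{}_a^{\mathbb{T}}D_t^\alpha u\|_{L_\Delta^p}^p$.
   Context: $\mathbb{T}$ is a time scale (nonempty closed subset of $\mathbb{R}$) with forward jump operator $\sigma(t)=\inf\{s\in\mathbb{T}:s>t\}$ ($\inf\emptyset=\sup\mathbb{T}$); $a,b\in\mathbb{T}$ with $0<a<b$; $J=[a,b]\cap\mathbb{T}$, $J^0=[a,b)\cap\mathbb{T}$; $f^\Delta$ denotes the delta derivative and $\int\cdot\,\Delta t$ the (Lebesgue) $\Delta$-integral, with $\int_a^b=\int_{J^0}$. $L_\Delta^p$ is the space of $\Delta$-measurable functions $u:J\to\mathbb{R}^N$ with $\|u\|_{L^p_\Delta}=(\int_{J^0}|u|^p\Delta t)^{1/p}<\infty$. Fractional integrals of order $\alpha>0$: ${}_a^{\mathbb{T}}I_t^\alpha h(t)=\frac1{\Gamma(\alpha)}\int_a^t(t-\sigma(s))^{\alpha-1}h(s)\Delta s$ and ${}_t^{\mathbb{T}}I_b^\alpha h(t)=\frac1{\Gamma(\alpha)}\int_t^b(s-\sigma(t))^{\alpha-1}h(s)\Delta s$ (order $0$ is the identity). For $0<\alpha\le1$ the left and right Riemann-Liouville derivatives are ${}_a^{\mathbb{T}}D_t^\alpha h=({}_a^{\mathbb{T}}I_t^{1-\alpha}h)^\Delta$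 and ${}_t^{\mathbb{T}}D_b^\alpha h=-({}_t^{\mathbb{T}}I_b^{1-\alpha}h)^\Delta$. $W_{\Delta,a^+}^{\alpha,p}$ is the set of all $u\in L_\Delta^p$ for which there exists $g\in L_\Delta^p$ such that $\int_{J^0}u(t)\cdot{}_t^{\mathbb{T}}D_b^\alpha\varphi(t)\Delta t=\int_{J^0}g(t)\cdot\varphi(t)\Delta t$ for all $\varphi\in C_{c,rd}^\infty$, where $C_{c,rd}^\infty$ is the set of functions $\varphi:J\to\mathbb{R}^N$ that are infinitely often $\Delta$-differentiable with rd-continuous derivatives and have compact support in $(a,b)\cap\mathbb{T}$. In the paper, $u\in W_{\Delta,a^+}^{\alpha,p}$ has a left Riemann-Liouville derivative ${}_a^{\mathbb{T}}D_t^\alpha u\in L_\Delta^p$, equal to $g$ $\Delta$-a.e.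
   Formalization: As D u can fail to exist for u in W (e.g. T=[1,2]∪[3,4], α=1), the norm uses D u if it exists a.e. in L^p, otherwise the infimum over weak derivatives g; kernel powers undefined at scattered points get conventional values (0^x=0, |y|^x for y<0). *)

theory Defs
  imports "HOL-Analysis.Analysis"
begin

text \<open>
  \<open>J = {a..b} \<inter> T\<close> is itself a time scale. Functions \<open>J \<rightarrow> E\<close> are represented by functions
  \<open>real \<Rightarrow> E\<close>; their values outside \<open>J\<close> never matter.
\<close>

abbreviation tsJ :: "real set \<Rightarrow> real \<Rightarrow> real \<Rightarrow> real set" where
  "tsJ T a b \<equiv> {a..b} \<inter> T"

abbreviation tsJ0 :: "real set \<Rightarrow> real \<Rightarrow> real \<Rightarrow> real set" where
  "tsJ0 T a b \<equiv> {a..<b} \<inter> T"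

definition fjump :: "real set \<Rightarrow> real \<Rightarrow> real" where
  "fjump K t = (if \<exists>s\<in>K. s > t then Inf {s\<in>K. s > t} else Sup K)"

definition bjump :: "real set \<Rightarrow> real \<Rightarrow> real" where
  "bjump K t = (if \<exists>s\<in>K. s < t then Sup {s\<in>K. s < t} else Inf K)"

text \<open>\<open>K\<^sup>\<kappa>\<close> for a bounded time scale \<open>K\<close>: a left-scattered maximum is removed.\<close>

definition ts_kappa :: "real set \<Rightarrow> real set" where
  "ts_kappa K = (if bjump K (Sup K) < Sup K then K - {Sup K} else K)"

definition has_delta_deriv ::
  "real set \<Rightarrow> (real \<Rightarrow> 'e::real_normed_vector) \<Rightarrow> 'e \<Rightarrow> real \<Rightarrow> bool" where
  "has_delta_deriv K f c t \<longleftrightarrow>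
    (\<forall>e>0. \<exists>d>0. \<forall>s\<in>K. \<bar>s - t\<bar> < d \<longrightarrow>
       norm (f (fjump K t) - f s - (fjump K t - s) *\<^sub>R c) \<le> e * \<bar>fjump K t - s\<bar>)"

definition delta_deriv ::
  "real set \<Rightarrow> (real \<Rightarrow> 'e::real_normed_vector) \<Rightarrow> real \<Rightarrow> 'e" where
  "delta_deriv K f t = (SOME c. has_delta_deriv K f c t)"

definition rd_continuous_on :: "real set \<Rightarrow> (real \<Rightarrow> 'e::real_normed_vector) \<Rightarrow> bool" where
  "rd_continuous_on K f \<longleftrightarrow>
    (\<forall>t\<in>K. t < Sup K \<and> fjump K t = t \<longrightarrow> continuous (at t within K) f) \<and>
    (\<forall>t\<in>K. Inf K < t \<and> bjump K t = t \<longrightarrow> (\<exists>l. (f \<longlongrightarrow> l) (at t within (K \<inter> {..<t}))))"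

text \<open>
  The Lebesgue \<open>\<Delta>\<close>-measure on \<open>[a,b) \<inter> T\<close>: the completed extension of
  \<open>[c,d) \<inter> T \<mapsto> d - c\<close> (\<open>c, d \<in> J\<close>), i.e. the Caratheodory extension. Existence of the extension
  is \<open>emeasure_delta_measure\<close> below; it is unique because the total mass \<open>b - a\<close> is finite.
\<close>

definition delta_measure :: "real set \<Rightarrow> real \<Rightarrow> real \<Rightarrow> real measure" where
  "delta_measure T a b = completion
     (extend_measure (tsJ0 T a b)
        {(c, d). c \<in> tsJ T a b \<and> d \<in> tsJ T a b \<and> c \<le> d}
        (\<lambda>(c, d). {c..<d} \<inter> T)
        (\<lambda>(c, d). ennreal (d - c)))"

lemma emeasure_delta_measure:
  assumes T: "closed T" and ab: "a \<in> T" "b \<in> T" "a < b"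
    and cd: "c \<in> tsJ T a b" "d \<in> tsJ T a b" "c \<le> d"
  shows "emeasure (delta_measure T a b) ({c..<d} \<inter> T) = ennreal (d - c)"
proof -
  define M where "M = extend_measure (tsJ0 T a b)
        {(c, d). c \<in> tsJ T a b \<and> d \<in> tsJ T a b \<and> c \<le> d}
        (\<lambda>(c, d). {c..<d} \<inter> T) (\<lambda>(c, d). ennreal (d - c))"
  define G where "G = (\<lambda>(c, d). {c..<d} \<inter> T) `
        {(c, d). c \<in> tsJ T a b \<and> d \<in> tsJ T a b \<and> c \<le> d}"
  have GP: "G \<subseteq> Pow (tsJ0 T a b)" unfolding G_def by auto
  have sM: "sets M = sigma_sets (tsJ0 T a b) G" and spM: "space M = tsJ0 T a b"
    using GP unfolding M_def G_def by (simp_all add: sets_extend_measure space_extend_measure)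
  define r where "r x = Sup ({a..x} \<inter> T)" for x
  have r_in: "r x \<in> {a..x} \<inter> T" if "a \<le> x" for x
  proof -
    have "compact ({a..x} \<inter> T)" using T by (simp add: compact_Int_closed)
    moreover have "{a..x} \<inter> T \<noteq> {}" using that ab by auto
    ultimately show ?thesis unfolding r_def
      by (intro closed_contains_Sup) (auto intro: compact_imp_closed)
  qed
  have r_ge: "s \<le> r x" if "s \<in> T" "a \<le> s" "s \<le> x" for s x
    unfolding r_def by (rule cSup_upper) (use that in auto)
  have pre: "r -` ({c..<d} \<inter> T) \<inter> {a..<b} = {c..<d}"
    if "c \<in> tsJ T a b" "d \<in> tsJ T a b" for c d
  proof (intro set_eqI iffI)
    fix x assume "x \<in> r -` ({c..<d} \<inter> T) \<inter> {a..<b}"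
    then have x: "a \<le> x" "c \<le> r x" "r x < d" by auto
    show "x \<in> {c..<d}" using r_in[OF x(1)] x r_ge[of d x] that by force
  next
    fix x assume "x \<in> {c..<d}"
    then show "x \<in> r -` ({c..<d} \<inter> T) \<inter> {a..<b}"
      using r_in[of x] r_ge[of c x] that by auto
  qed
  define N where "N = restrict_space lborel {a..<b}"
  have rm: "r \<in> measurable N M"
  proof (rule measurable_sigma_sets[OF sM GP])
    show "r \<in> space N \<rightarrow> tsJ0 T a b"
      using r_in by (fastforce simp: N_def space_restrict_space)
    fix y assume "y \<in> G"
    then obtain c d where "c \<in> tsJ T a b" "d \<in> tsJ T a b" "y = {c..<d} \<inter> T"
      unfolding G_def by auto
    then have "r -` y \<inter> space N = {c..<d}" "{c..<d} \<subseteq> {a..<b}"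
      using pre by (auto simp: N_def space_restrict_space)
    then show "r -` y \<inter> space N \<in> sets N"
      by (auto simp: N_def sets_restrict_space_iff)
  qed
  let ?m = "emeasure (distr N M r)"
  have "emeasure M ({c..<d} \<inter> T) = ennreal (d - c)"
  proof (rule emeasure_extend_measure_Pair[where I = "\<lambda>c d. c \<in> tsJ T a b \<and> d \<in> tsJ T a b \<and> c \<le> d"
        and G = "\<lambda>c d. {c..<d} \<inter> T" and \<mu> = "\<lambda>c d. ennreal (d - c)" and \<mu>' = ?m and \<Omega> = "tsJ0 T a b"])
    show "M = extend_measure (tsJ0 T a b) {(i, j). i \<in> tsJ T a b \<and> j \<in> tsJ T a b \<and> i \<le> j}
       (\<lambda>(i, j). {i..<j} \<inter> T) (\<lambda>(i, j). ennreal (j - i))" by (simp add: M_def)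
    show "positive (sets M) ?m" using emeasure_positive[of "distr N M r"] by simp
    show "countably_additive (sets M) ?m"
      using emeasure_countably_additive[of "distr N M r"] by simp
    show "c \<in> tsJ T a b \<and> d \<in> tsJ T a b \<and> c \<le> d" using cd by simp
    fix i j assume ij: "i \<in> tsJ T a b \<and> j \<in> tsJ T a b \<and> i \<le> j"
    show "{i..<j} \<inter> T \<in> Pow (tsJ0 T a b)" using ij by auto
    have "{i..<j} \<inter> T \<in> sets M" unfolding sM G_def using ij
      by (intro sigma_sets.Basic) auto
    then have "?m ({i..<j} \<inter> T) = emeasure N (r -` ({i..<j} \<inter> T) \<inter> space N)"
      by (rule emeasure_distr[OF rm])
    also have "r -` ({i..<j} \<inter> T) \<inter> space N = {i..<j}"
      using pre ij by (simp add: N_def space_restrict_space)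
    also have "emeasure N {i..<j} = emeasure lborel {i..<j}"
      unfolding N_def using ij by (intro emeasure_restrict_space) auto
    finally show "?m ({i..<j} \<inter> T) = ennreal (j - i)" using ij by simp
  qed
  moreover have "{c..<d} \<inter> T \<in> sets M" unfolding sM G_def using cd
    by (intro sigma_sets.Basic) auto
  ultimately show ?thesis by (simp add: delta_measure_def M_def)
qed

definition Lp_delta ::
  "real set \<Rightarrow> real \<Rightarrow> real \<Rightarrow> real \<Rightarrow> (real \<Rightarrow> 'e::euclidean_space) set" where
  "Lp_delta T a b p = {u \<in> borel_measurable (delta_measure T a b).
     integrable (delta_measure T a b) (\<lambda>t. norm (u t) powr p)}"

definition Lp_delta_norm ::
  "real set \<Rightarrow> real \<Rightarrow> real \<Rightarrow> real \<Rightarrow> (real \<Rightarrow> 'e::euclidean_space) \<Rightarrow> real" where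
  "Lp_delta_norm T a b p u =
     (LINT t|delta_measure T a b. norm (u t) powr p) powr (1 / p)"

text \<open>
  Fractional integrals of order \<open>\<beta>\<close>. The bases of the kernels can vanish or be negative at
  right-scattered points; then \<open>powr\<close> has the library values \<open>0 powr x = 0\<close> and
  \<open>(- y) powr x = y powr x\<close>.
\<close>

definition frac_int_left ::
  "real set \<Rightarrow> real \<Rightarrow> real \<Rightarrow> real \<Rightarrow> (real \<Rightarrow> 'e::euclidean_space) \<Rightarrow> real \<Rightarrow> 'e" where
  "frac_int_left T a b \<beta> h t =
    (if \<beta> = 0 then h t
     else (1 / Gamma \<beta>) *\<^sub>R
       (LINT s:{a..<t} \<inter> T|delta_measure T a b. ((t - fjump T s) powr (\<beta> - 1)) *\<^sub>R h s))"

definition frac_int_right ::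
  "real set \<Rightarrow> real \<Rightarrow> real \<Rightarrow> real \<Rightarrow> (real \<Rightarrow> 'e::euclidean_space) \<Rightarrow> real \<Rightarrow> 'e" where
  "frac_int_right T a b \<beta> h t =
    (if \<beta> = 0 then h t
     else (1 / Gamma \<beta>) *\<^sub>R
       (LINT s:{t..<b} \<inter> T|delta_measure T a b. ((s - fjump T t) powr (\<beta> - 1)) *\<^sub>R h s))"

definition RL_left ::
  "real set \<Rightarrow> real \<Rightarrow> real \<Rightarrow> real \<Rightarrow> (real \<Rightarrow> 'e::euclidean_space) \<Rightarrow> real \<Rightarrow> 'e" where
  "RL_left T a b \<alpha> h = delta_deriv (tsJ T a b) (frac_int_left T a b (1 - \<alpha>) h)"

definition RL_right ::
  "real set \<Rightarrow> real \<Rightarrow> real \<Rightarrow> real \<Rightarrow> (real \<Rightarrow> 'e::euclidean_space) \<Rightarrow> real \<Rightarrow> 'e" where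
  "RL_right T a b \<alpha> h t = - delta_deriv (tsJ T a b) (frac_int_right T a b (1 - \<alpha>) h) t"

text \<open>
  \<open>RL_left\<close> is an unspecified value where the \<open>\<Delta>\<close>-derivative does not exist; the following says that
  \<open>h\<close> really has a left Riemann-Liouville derivative \<open>\<Delta>\<close>-a.e.
\<close>

definition has_RL_left ::
  "real set \<Rightarrow> real \<Rightarrow> real \<Rightarrow> real \<Rightarrow> (real \<Rightarrow> 'e::euclidean_space) \<Rightarrow> bool" where
  "has_RL_left T a b \<alpha> h \<longleftrightarrow>
    (\<alpha> < 1 \<longrightarrow> (\<forall>t\<in>tsJ T a b. set_integrable (delta_measure T a b) ({a..<t} \<inter> T)
       (\<lambda>s. ((t - fjump T s) powr (- \<alpha>)) *\<^sub>R h s))) \<and>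
    (AE t in delta_measure T a b.
       \<exists>c. has_delta_deriv (tsJ T a b) (frac_int_left T a b (1 - \<alpha>) h) c t)"

text \<open>
  \<open>C\<^sup>\<infinity>\<^sub>c\<^sub>,\<^sub>r\<^sub>d\<close>: \<open>F n\<close> is the \<open>n\<close>-th \<open>\<Delta>\<close>-derivative of \<open>\<phi>\<close>, a function on the \<open>n\<close>-fold \<open>\<kappa>\<close>-truncation
  of \<open>J\<close>.
\<close>

definition test_functions ::
  "real set \<Rightarrow> real \<Rightarrow> real \<Rightarrow> (real \<Rightarrow> 'e::euclidean_space) set" where
  "test_functions T a b = {\<phi>.
     (\<exists>F :: nat \<Rightarrow> real \<Rightarrow> 'e. F 0 = \<phi> \<and>
        (\<forall>n. rd_continuous_on ((ts_kappa ^^ n) (tsJ T a b)) (F n) \<and>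
             (\<forall>t\<in>(ts_kappa ^^ Suc n) (tsJ T a b).
                has_delta_deriv ((ts_kappa ^^ n) (tsJ T a b)) (F n) (F (Suc n) t) t))) \<and>
     (\<exists>C. compact C \<and> C \<subseteq> {a<..<b} \<inter> T \<and> (\<forall>t\<in>tsJ T a b - C. \<phi> t = 0))}"

text \<open>The integral identity includes the existence of both integrals.\<close>

definition weak_left_deriv ::
  "real set \<Rightarrow> real \<Rightarrow> real \<Rightarrow> real \<Rightarrow>
   (real \<Rightarrow> 'e::euclidean_space) \<Rightarrow> (real \<Rightarrow> 'e) \<Rightarrow> bool" where
  "weak_left_deriv T a b \<alpha> u g \<longleftrightarrow>
    (\<forall>\<phi>\<in>test_functions T a b.
       integrable (delta_measure T a b) (\<lambda>t. u t \<bullet> RL_right T a b \<alpha> \<phi> t) \<and>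
       integrable (delta_measure T a b) (\<lambda>t. g t \<bullet> \<phi> t) \<and>
       (LINT t|delta_measure T a b. u t \<bullet> RL_right T a b \<alpha> \<phi> t) =
       (LINT t|delta_measure T a b. g t \<bullet> \<phi> t))"

definition W_space ::
  "real set \<Rightarrow> real \<Rightarrow> real \<Rightarrow> real \<Rightarrow> real \<Rightarrow> (real \<Rightarrow> 'e::euclidean_space) set" where
  "W_space T a b \<alpha> p =
    {u \<in> Lp_delta T a b p. \<exists>g\<in>Lp_delta T a b p. weak_left_deriv T a b \<alpha> u g}"

text \<open>
  The left derivative of \<open>u \<in> W\<close>: the Riemann-Liouville derivative \<open>RL_left\<close> of the function \<open>u\<close>
  whenever it exists \<open>\<Delta>\<close>-a.e. and lies in \<open>L\<^sup>p\<close>. For \<open>\<alpha> = 1\<close> even on an interval \<open>u\<close> need not be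
  differentiable itself, only some function equal to it \<open>\<Delta>\<close>-a.e. is; then the derivative is
  the \<open>g\<close> of the definition of \<open>W\<close>, with which the Riemann-Liouville derivative is identified.
  Two such \<open>g\<close> may differ at a right-scattered \<open>a\<close>, where all test functions vanish, hence a set.
\<close>

definition left_derivs ::
  "real set \<Rightarrow> real \<Rightarrow> real \<Rightarrow> real \<Rightarrow> real \<Rightarrow>
   (real \<Rightarrow> 'e::euclidean_space) \<Rightarrow> (real \<Rightarrow> 'e) set" where
  "left_derivs T a b \<alpha> p u =
    (if has_RL_left T a b \<alpha> u \<and> RL_left T a b \<alpha> u \<in> Lp_delta T a b p
     then {RL_left T a b \<alpha> u}
     else {g \<in> Lp_delta T a b p. weak_left_deriv T a b \<alpha> u g})"

text \<open>The infimum is over a single value whenever the derivative is unique \<open>\<Delta>\<close>-a.e.\<close>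

definition W_norm ::
  "real set \<Rightarrow> real \<Rightarrow> real \<Rightarrow> real \<Rightarrow> real \<Rightarrow> (real \<Rightarrow> 'e::euclidean_space) \<Rightarrow> real" where
  "W_norm T a b \<alpha> p u =
    (INF h\<in>left_derivs T a b \<alpha> p u.
       (Lp_delta_norm T a b p u powr p + Lp_delta_norm T a b p h powr p) powr (1 / p))"

text \<open>
  Separability for functions not identified modulo \<open>\<Delta>\<close>-null sets: a countable dense subset
  in the distance \<open>N (u - v)\<close>.
\<close>

definition separable_wrt ::
  "((real \<Rightarrow> 'e::real_vector) \<Rightarrow> real) \<Rightarrow> (real \<Rightarrow> 'e) set \<Rightarrow> bool" where
  "separable_wrt N W \<longleftrightarrow>
    (\<exists>Q. countable Q \<and> Q \<subseteq> W \<and> (\<forall>u\<in>W. \<forall>e>0. \<exists>q\<in>Q. N (\<lambda>t. u t - q t) < e))"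

end

theory Submission
  imports Defs
begin

text \<open>
  The class \<open>L\<^sup>p\<close> of the delta measure is separable: the measure of \<open>[c,d) \<inter> T\<close> is \<open>d - c\<close>, so it
  depends continuously on the end points, and step functions with end points from a countable dense
  subset of \<open>[a,b] \<inter> T\<close> and values from a countable dense set of vectors approximate every
  function (\<open>Lp_delta_separable\<close>).
  Consequently every set of pairs \<open>(u, g)\<close> in \<open>L\<^sup>p \<times> L\<^sup>p\<close> has a countable dense subset
  (\<open>Lp_class_pairs_separable\<close>). Separability of a Sobolev space is usually the case of the graph of
  the derivative.

  Here there are two graphs. The norm of \<open>w\<close> uses the Riemann-Liouville derivative where it exists
  almost everywhere and lies in \<open>L\<^sup>p\<close> (call such \<open>w\<close> classical), and a weak derivative
  otherwise; on a time scale the two can differ, so the norm need not satisfy the triangle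
  inequality. The argument avoids any comparison of the two derivatives. The classical functions are
  closed under differences, and on them the Riemann-Liouville derivative is linear almost everywhere
  (\<open>RL_left_diff\<close>). Let \<open>A\<close> be a countable dense subset of the graph of the weak derivative and
  \<open>B\<close> one of the graph of the Riemann-Liouville derivative over the classical functions of \<open>W\<close>.
  Given \<open>u \<in> W\<close>, choose \<open>v\<close> from \<open>A\<close> such that \<open>u - v\<close> and its weak derivative are small. If \<open>u - v\<close>
  is not classical, the norm of \<open>u - v\<close> is bounded by these quantities. If it is classical, choose
  \<open>w\<close> from \<open>B\<close> near \<open>u - v\<close>; then \<open>u - (v + w)\<close> is again classical and has small norm. So the
  functions \<open>v\<close> and \<open>v + w\<close> form a countable dense set.

  Distances are measured by the p-modular \<open>\<integral> |f|\<^sup>p\<close>. It satisfies a triangle inequality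
  up to the factor \<open>2\<^sup>p\<close>, which is enough for density arguments and spares Minkowski's inequality.
\<close>

section \<open>The class of functions with integrable p-th power\<close>

definition Lp_class :: "'a measure \<Rightarrow> real \<Rightarrow> ('a \<Rightarrow> 'e::euclidean_space) set" where
  "Lp_class M p = {f \<in> borel_measurable M. integrable M (\<lambda>x. norm (f x) powr p)}"

definition p_modular :: "'a measure \<Rightarrow> real \<Rightarrow> ('a \<Rightarrow> 'e::euclidean_space) \<Rightarrow> real" where
  "p_modular M p f = (LINT x|M. norm (f x) powr p)"

text \<open>
  The sum has norm at most twice the larger norm, and the p-th power of a maximum is at most the sum
  of the p-th powers. This crude bound replaces convexity, so it holds for every exponent \<open>p \<ge> 0\<close>.
\<close>

lemma norm_add_powr_le:
  fixes x y :: "'e::real_normed_vector"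
  assumes "0 \<le> p"
  shows "norm (x + y) powr p \<le> 2 powr p * (norm x powr p + norm y powr p)"
proof -
  have "norm (x + y) powr p \<le> (2 * max (norm x) (norm y)) powr p"
    by (rule powr_mono2) (use assms norm_triangle_ineq[of x y] in auto)
  also have "\<dots> = 2 powr p * max (norm x) (norm y) powr p"
    by (simp add: powr_mult)
  also have "\<dots> \<le> 2 powr p * (norm x powr p + norm y powr p)"
    by (rule mult_left_mono) (auto simp: max_def)
  finally show ?thesis .
qed

lemma p_modular_nonneg: "0 \<le> p_modular M p f"
  unfolding p_modular_def by (rule integral_nonneg_AE) simp

lemma Lp_class_add:
  assumes "0 \<le> p" "f \<in> Lp_class M p" "g \<in> Lp_class M p"
  shows "(\<lambda>x. f x + g x) \<in> Lp_class M p"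
proof -
  have [measurable]: "f \<in> borel_measurable M" "g \<in> borel_measurable M"
    and i: "integrable M (\<lambda>x. 2 powr p * (norm (f x) powr p + norm (g x) powr p))"
    using assms by (auto simp: Lp_class_def)
  have "integrable M (\<lambda>x. norm (f x + g x) powr p)"
    by (rule Bochner_Integration.integrable_bound[OF i])
       (use norm_add_powr_le[OF assms(1)] in auto)
  then show ?thesis by (simp add: Lp_class_def)
qed

lemma Lp_class_uminus: "f \<in> Lp_class M p \<Longrightarrow> (\<lambda>x. - f x) \<in> Lp_class M p"
  by (simp add: Lp_class_def)

lemma Lp_class_diff:
  assumes "0 \<le> p" "f \<in> Lp_class M p" "g \<in> Lp_class M p"
  shows "(\<lambda>x. f x - g x) \<in> Lp_class M p"
  using Lp_class_add[OF assms(1,2) Lp_class_uminus[OF assms(3)]] by simp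

lemma p_modular_add_le:
  assumes "0 \<le> p" "f \<in> Lp_class M p" "g \<in> Lp_class M p"
  shows "p_modular M p (\<lambda>x. f x + g x) \<le> 2 powr p * (p_modular M p f + p_modular M p g)"
proof -
  have "p_modular M p (\<lambda>x. f x + g x) \<le>
      (LINT x|M. 2 powr p * (norm (f x) powr p + norm (g x) powr p))"
    unfolding p_modular_def
    by (rule integral_mono)
       (use Lp_class_add[OF assms] assms norm_add_powr_le[OF assms(1)] in \<open>auto simp: Lp_class_def\<close>)
  then show ?thesis using assms by (simp add: p_modular_def Lp_class_def)
qed

lemma p_modular_diff_commute: "p_modular M p (\<lambda>x. f x - g x) = p_modular M p (\<lambda>x. g x - f x)"
  by (simp add: p_modular_def norm_minus_commute)

lemma p_modular_triangle:
  assumes "0 \<le> p" "f \<in> Lp_class M p" "g \<in> Lp_class M p" "h \<in> Lp_class M p"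
  shows "p_modular M p (\<lambda>x. f x - h x) \<le>
    2 powr p * (p_modular M p (\<lambda>x. f x - g x) + p_modular M p (\<lambda>x. g x - h x))"
  using p_modular_add_le[OF assms(1) Lp_class_diff[OF assms(1,2,3)] Lp_class_diff[OF assms(1,3,4)]]
  by simp

lemma p_modular_cong_AE:
  assumes "f \<in> borel_measurable M" "g \<in> borel_measurable M" "AE x in M. f x = g x"
  shows "p_modular M p f = p_modular M p g"
  unfolding p_modular_def by (rule integral_cong_AE) (use assms in auto)

lemma Lp_class_cong_AE:
  assumes "f \<in> Lp_class M p" "g \<in> borel_measurable M" "AE x in M. f x = g x"
  shows "g \<in> Lp_class M p"
proof -
  have "integrable M (\<lambda>x. norm (g x) powr p)"
    by (rule integrable_cong_AE_imp[where g = "\<lambda>x. norm (f x) powr p"])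
       (use assms in \<open>auto simp: Lp_class_def\<close>)
  then show ?thesis using assms by (simp add: Lp_class_def)
qed

lemma Lp_class_indicator:
  assumes "A \<in> sets M" "emeasure M A < \<infinity>"
  shows "(\<lambda>x. indicator A x *\<^sub>R v) \<in> Lp_class M p"
    and "p_modular M p (\<lambda>x. indicator A x *\<^sub>R v) = norm v powr p * measure M A"
proof -
  have *: "(\<lambda>x. norm (indicator A x *\<^sub>R v) powr p) = (\<lambda>x. indicator A x *\<^sub>R (norm v powr p))"
    by (auto simp: indicator_def fun_eq_iff)
  show "(\<lambda>x. indicator A x *\<^sub>R v) \<in> Lp_class M p"
    unfolding Lp_class_def mem_Collect_eq * using assms
    by (intro conjI borel_measurable_scaleR borel_measurable_indicator borel_measurable_const
        integrable_scaleR_left integrable_real_indicator)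
  show "p_modular M p (\<lambda>x. indicator A x *\<^sub>R v) = norm v powr p * measure M A"
    unfolding p_modular_def *
    by (subst integral_scaleR_left)
       (use assms sets.sets_into_space[OF assms(1)] in \<open>auto simp: Int_absorb2 intro: integrable_real_indicator\<close>)
qed

section \<open>Approximation by a family of functions\<close>

definition Lp_closure ::
  "'a measure \<Rightarrow> real \<Rightarrow> ('a \<Rightarrow> 'e::euclidean_space) set \<Rightarrow> ('a \<Rightarrow> 'e) set" where
  "Lp_closure M p Q =
    {f \<in> Lp_class M p. \<forall>e>0. \<exists>q\<in>Q. p_modular M p (\<lambda>x. f x - q x) < e}"

lemma Lp_closure_superset: "Q \<subseteq> Lp_class M p \<Longrightarrow> Q \<subseteq> Lp_closure M p Q"
  by (force simp: Lp_closure_def p_modular_def)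

lemma Lp_closure_closed:
  assumes p: "0 \<le> p" and Q: "Q \<subseteq> Lp_class M p" and f: "f \<in> Lp_class M p"
    and ap: "\<And>e. 0 < e \<Longrightarrow> \<exists>g\<in>Lp_closure M p Q. p_modular M p (\<lambda>x. f x - g x) < e"
  shows "f \<in> Lp_closure M p Q"
  unfolding Lp_closure_def
proof (intro CollectI conjI f allI impI)
  fix e :: real assume e: "0 < e"
  define d where "d = e / (2 * 2 powr p)"
  have d: "0 < d" "2 powr p * (d + d) = e" using e by (auto simp: d_def)
  obtain g where g: "g \<in> Lp_closure M p Q" "p_modular M p (\<lambda>x. f x - g x) < d"
    using ap[OF d(1)] by blast
  then obtain q where q: "q \<in> Q" "p_modular M p (\<lambda>x. g x - q x) < d"
    using d(1) by (auto simp: Lp_closure_def)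
  have "p_modular M p (\<lambda>x. f x - q x) \<le>
      2 powr p * (p_modular M p (\<lambda>x. f x - g x) + p_modular M p (\<lambda>x. g x - q x))"
    by (rule p_modular_triangle[OF p f]) (use g q Q in \<open>auto simp: Lp_closure_def\<close>)
  also have "\<dots> < 2 powr p * (d + d)" using g(2) q(2) by simp
  finally show "\<exists>q\<in>Q. p_modular M p (\<lambda>x. f x - q x) < e" using q(1) d(2) by auto
qed

lemma Lp_closure_add:
  assumes p: "0 \<le> p" and Q: "Q \<subseteq> Lp_class M p"
    and Qadd: "\<forall>q\<in>Q. \<forall>r\<in>Q. (\<lambda>x. q x + r x) \<in> Q"
    and f: "f \<in> Lp_closure M p Q" and g: "g \<in> Lp_closure M p Q"
  shows "(\<lambda>x. f x + g x) \<in> Lp_closure M p Q"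
  unfolding Lp_closure_def
proof (intro CollectI conjI allI impI)
  have fg: "f \<in> Lp_class M p" "g \<in> Lp_class M p" using f g by (auto simp: Lp_closure_def)
  show "(\<lambda>x. f x + g x) \<in> Lp_class M p" using Lp_class_add[OF p fg] .
  fix e :: real assume e: "0 < e"
  define d where "d = e / (2 * 2 powr p)"
  have d: "0 < d" "2 powr p * (d + d) = e" using e by (auto simp: d_def)
  obtain q r where q: "q \<in> Q" "p_modular M p (\<lambda>x. f x - q x) < d"
    and r: "r \<in> Q" "p_modular M p (\<lambda>x. g x - r x) < d"
    using f g d(1) unfolding Lp_closure_def by blast
  have "p_modular M p (\<lambda>x. (f x + g x) - (q x + r x)) =
      p_modular M p (\<lambda>x. (f x - q x) + (g x - r x))" by (simp add: algebra_simps)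
  also have "\<dots> \<le> 2 powr p * (p_modular M p (\<lambda>x. f x - q x) + p_modular M p (\<lambda>x. g x - r x))"
    by (rule p_modular_add_le[OF p]) (use Q q r fg in \<open>auto intro!: Lp_class_diff[OF p]\<close>)
  also have "\<dots> < 2 powr p * (d + d)" using q(2) r(2) by simp
  finally show "\<exists>q\<in>Q. p_modular M p (\<lambda>x. (f x + g x) - q x) < e"
    using Qadd q(1) r(1) d(2) by (intro bexI[where x = "\<lambda>x. q x + r x"]) auto
qed

lemma Lp_closure_cong_AE:
  assumes p: "0 \<le> p" and Q: "Q \<subseteq> Lp_class M p"
    and f: "f \<in> Lp_closure M p Q" and g: "g \<in> borel_measurable M" and ae: "AE x in M. f x = g x"
  shows "g \<in> Lp_closure M p Q"
proof (rule Lp_closure_closed[OF p Q])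
  have fL: "f \<in> Lp_class M p" using f by (simp add: Lp_closure_def)
  show "g \<in> Lp_class M p" by (rule Lp_class_cong_AE[OF fL g ae])
  have "p_modular M p (\<lambda>x. g x - f x) = p_modular M p (\<lambda>x. 0::'b)"
    by (rule p_modular_cong_AE) (use fL g ae in \<open>auto simp: Lp_class_def\<close>)
  then show "\<exists>h\<in>Lp_closure M p Q. p_modular M p (\<lambda>x. g x - h x) < e" if "0 < e" for e
    using f that by (intro bexI[where x = f]) (auto simp: p_modular_def)
qed

text \<open>
  Dominated convergence: \<open>|f - F\<^sub>n|\<^sup>p\<close> tends to 0 pointwise and is at most \<open>2\<^sup>p (|g|\<^sup>p + |g|\<^sup>p)\<close>. This is the
  form in which countable unions of sets and limits of simple functions enter the approximation.
\<close>

lemma Lp_closure_dominated: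
  assumes p: "0 < p" and Q: "Q \<subseteq> Lp_class M p"
    and F: "\<And>n. F n \<in> Lp_closure M p Q"
    and lim: "\<And>x. x \<in> space M \<Longrightarrow> (\<lambda>n. F n x) \<longlonglongrightarrow> f x"
    and dom: "\<And>n x. x \<in> space M \<Longrightarrow> norm (F n x) \<le> norm (g x)" and g: "g \<in> Lp_class M p"
  shows "f \<in> Lp_closure M p Q"
proof (rule Lp_closure_closed[OF less_imp_le[OF p] Q])
  have [measurable]: "F n \<in> borel_measurable M" for n using F by (auto simp: Lp_closure_def Lp_class_def)
  have [measurable]: "f \<in> borel_measurable M"
    by (rule borel_measurable_LIMSEQ_metric[where f = F]) (use lim in auto)
  have [measurable]: "g \<in> borel_measurable M" using g by (auto simp: Lp_class_def)
  have fg: "norm (f x) \<le> norm (g x)" if "x \<in> space M" for x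
    by (rule LIMSEQ_le_const2[OF tendsto_norm[OF lim[OF that]]]) (use dom that in auto)
  have gi: "integrable M (\<lambda>x. norm (g x) powr p)" using g by (auto simp: Lp_class_def)
  have "norm (norm (f x) powr p) \<le> norm (norm (g x) powr p)" if "x \<in> space M" for x
    using powr_mono2[OF less_imp_le[OF p] norm_ge_zero fg[OF that]] by simp
  then have "integrable M (\<lambda>x. norm (f x) powr p)"
    by (intro Bochner_Integration.integrable_bound[OF gi] AE_I2) measurable
  then show "f \<in> Lp_class M p" by (simp add: Lp_class_def)
  have "(\<lambda>n. LINT x|M. norm (f x - F n x) powr p) \<longlonglongrightarrow> (LINT x|M. 0)"
  proof (rule integral_dominated_convergence[where w = "\<lambda>x. 2 powr p * (norm (g x) powr p + norm (g x) powr p)"])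
    show "AE x in M. (\<lambda>n. norm (f x - F n x) powr p) \<longlonglongrightarrow> 0"
    proof (rule AE_I2)
      fix x assume "x \<in> space M"
      then have "(\<lambda>n. norm (f x - F n x)) \<longlonglongrightarrow> norm (f x - f x)"
        by (intro tendsto_intros lim)
      then have "(\<lambda>n. norm (f x - F n x)) \<longlonglongrightarrow> 0" by simp
      then show "(\<lambda>n. norm (f x - F n x) powr p) \<longlonglongrightarrow> 0"
        using tendsto_powr'[of "\<lambda>n. norm (f x - F n x)" 0 sequentially "\<lambda>_. p" p] p by simp
    qed
    fix n
    show "AE x in M. norm (norm (f x - F n x) powr p) \<le> 2 powr p * (norm (g x) powr p + norm (g x) powr p)"
    proof (rule AE_I2)
      fix x assume x: "x \<in> space M"
      have "norm (f x - F n x) powr p \<le> 2 powr p * (norm (f x) powr p + norm (F n x) powr p)"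
        using norm_add_powr_le[of p "f x" "- F n x"] p by simp
      also have "\<dots> \<le> 2 powr p * (norm (g x) powr p + norm (g x) powr p)"
        using fg[OF x] dom[OF x] p by (intro mult_left_mono add_mono powr_mono2) auto
      finally show "norm (norm (f x - F n x) powr p) \<le> 2 powr p * (norm (g x) powr p + norm (g x) powr p)"
        by simp
    qed
  qed (use gi in auto)
  then have "(\<lambda>n. p_modular M p (\<lambda>x. f x - F n x)) \<longlonglongrightarrow> 0" by (simp add: p_modular_def)
  then show "\<exists>h\<in>Lp_closure M p Q. p_modular M p (\<lambda>x. f x - h x) < e" if "0 < e" for e
    using eventually_happens'[OF sequentially_bot order_tendstoD(2)[OF _ that]] F by blast
qed

lemma Lp_closure_sum:
  assumes p: "0 \<le> p" and Q: "Q \<subseteq> Lp_class M p" and z: "(\<lambda>x. 0) \<in> Q"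
    and Qadd: "\<forall>q\<in>Q. \<forall>r\<in>Q. (\<lambda>x. q x + r x) \<in> Q"
    and f: "\<And>i. i \<in> I \<Longrightarrow> f i \<in> Lp_closure M p Q"
  shows "(\<lambda>x. \<Sum>i\<in>I. f i x) \<in> Lp_closure M p Q"
proof (cases "finite I")
  case True
  then show ?thesis using f
  proof (induction I rule: finite_induct)
    case empty
    then show ?case using subsetD[OF Lp_closure_superset[OF Q] z] by simp
  next
    case (insert i I)
    have "(\<lambda>x. f i x + (\<Sum>i\<in>I. f i x)) \<in> Lp_closure M p Q"
      by (rule Lp_closure_add[OF p Q Qadd]) (use insert in auto)
    then show ?case using insert(1,2) by simp
  qed
next
  case False
  then show ?thesis using subsetD[OF Lp_closure_superset[OF Q] z] by simp
qed

section \<open>Separability of the class and of sets of pairs\<close>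

text \<open>
  A measurable \<open>f\<close> is the pointwise limit of simple functions bounded by \<open>2 |f|\<close>, and a simple function
  is a finite sum of multiples of indicators; hence it suffices to approximate the latter.
\<close>

lemma Lp_closure_eq_Lp_class:
  fixes Q :: "('a \<Rightarrow> 'e::euclidean_space) set"
  assumes p: "0 < p" and Q: "Q \<subseteq> Lp_class M p" and z: "(\<lambda>x. 0) \<in> Q"
    and Qadd: "\<forall>q\<in>Q. \<forall>r\<in>Q. (\<lambda>x. q x + r x) \<in> Q"
    and ind: "\<And>A v. A \<in> sets M \<Longrightarrow> (\<lambda>x. indicator A x *\<^sub>R v) \<in> Lp_closure M p Q"
  shows "Lp_closure M p Q = Lp_class M p"
proof
  show "Lp_closure M p Q \<subseteq> Lp_class M p" by (auto simp: Lp_closure_def)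
  show "Lp_class M p \<subseteq> Lp_closure M p Q"
  proof
    fix f :: "'a \<Rightarrow> 'e" assume f: "f \<in> Lp_class M p"
    then have [measurable]: "f \<in> borel_measurable M" by (simp add: Lp_class_def)
    from borel_measurable_implies_sequence_metric[OF this, of 0] obtain F where
      F: "\<And>i. simple_function M (F i)" "\<And>x. x \<in> space M \<Longrightarrow> (\<lambda>i. F i x) \<longlonglongrightarrow> f x"
        "\<And>i x. x \<in> space M \<Longrightarrow> norm (F i x) \<le> 2 * norm (f x)"
      by simp metis
    have "F i \<in> Lp_closure M p Q" for i
    proof (rule Lp_closure_cong_AE[OF less_imp_le[OF p] Q])
      show "(\<lambda>x. \<Sum>y\<in>F i ` space M. indicator (F i -` {y} \<inter> space M) x *\<^sub>R y) \<in> Lp_closure M p Q"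
        by (intro Lp_closure_sum[OF less_imp_le[OF p] Q z Qadd] ind simple_functionD(2)[OF F(1)])
      show "F i \<in> borel_measurable M" using F(1) by (rule borel_measurable_simple_function)
      show "AE x in M. (\<Sum>y\<in>F i ` space M. indicator (F i -` {y} \<inter> space M) x *\<^sub>R y) = F i x"
      proof (rule AE_I2)
        fix x assume x: "x \<in> space M"
        have "(\<Sum>y\<in>F i ` space M. indicator (F i -` {y} \<inter> space M) x *\<^sub>R y) =
            (\<Sum>y\<in>F i ` space M. if y = F i x then y else 0)"
          by (rule sum.cong) (use x in \<open>auto simp: indicator_def\<close>)
        then show "(\<Sum>y\<in>F i ` space M. indicator (F i -` {y} \<inter> space M) x *\<^sub>R y) = F i x"
          using x simple_functionD(1)[OF F(1), of i] by (simp add: sum.delta)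
      qed
    qed
    then show "f \<in> Lp_closure M p Q"
    proof (rule Lp_closure_dominated[OF p Q _ F(2)])
      show "norm (F n x) \<le> norm (f x + f x)" if "x \<in> space M" for n x
        using F(3)[OF that, of n] by (simp add: scaleR_2[symmetric])
      show "(\<lambda>x. f x + f x) \<in> Lp_class M p" using Lp_class_add[OF _ f f] p by simp
    qed
  qed
qed

definition step_fun :: "('e::real_vector \<times> 'a set) list \<Rightarrow> 'a \<Rightarrow> 'e" where
  "step_fun l x = (\<Sum>(v, A)\<leftarrow>l. indicator A x *\<^sub>R v)"

lemma step_fun_append: "step_fun (l @ m) x = step_fun l x + step_fun m x"
  by (simp add: step_fun_def)

text \<open>
  The countable family consists of the step functions over \<open>G0\<close> with values in a countable dense set
  of vectors. By the choice of \<open>G0\<close> it approximates \<open>indicator A *\<^sub>R v\<close> for \<open>A \<in> G\<close>. The sets \<open>A\<close> with this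
  property for all \<open>v\<close> are closed under complements and countable disjoint unions, so they comprise
  the whole \<open>\<sigma>\<close>-algebra by Dynkin's theorem. A set of the completion differs from its main part by a
  null set only.
\<close>

lemma Lp_class_separable:
  assumes p: "0 < p" and fin: "finite_measure M"
    and G: "Int_stable G" "G \<subseteq> Pow (space M)" "space M \<in> G"
    and sM: "sets M = sigma_sets (space M) G"
    and G0: "countable G0" "G0 \<subseteq> sets M"
    and ap: "\<And>A e. A \<in> G \<Longrightarrow> 0 < e \<Longrightarrow> \<exists>B\<in>G0. measure M (A - B \<union> (B - A)) < e"
  shows "\<exists>Q :: ('a \<Rightarrow> 'e::euclidean_space) set. countable Q \<and> Q \<subseteq> Lp_class (completion M) p \<and>
    Lp_closure (completion M) p Q = Lp_class (completion M) p"
proof -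
  interpret finite_measure M by (rule fin)
  let ?C = "completion M"
  let ?ind = "\<lambda>A v x. indicator A x *\<^sub>R (v :: 'e)"
  obtain D :: "'e set" where D: "countable D" "\<And>X. open X \<Longrightarrow> X \<noteq> {} \<Longrightarrow> \<exists>d\<in>D. d \<in> X"
    by (erule countable_dense_setE)
  define Q where "Q = step_fun ` lists (D \<times> G0)"
  have cQ: "countable Q" unfolding Q_def using D(1) G0(1) by (intro countable_image countable_lists) auto
  have fin_C: "emeasure ?C A < \<infinity>" if "A \<in> sets M" for A
    using that by (simp add: emeasure_eq_measure)
  have ind_L: "?ind A v \<in> Lp_class ?C p" if "A \<in> sets M" for A v
    using that fin_C by (intro Lp_class_indicator) auto
  have z: "(\<lambda>x. 0) \<in> Q"
    unfolding Q_def by (rule image_eqI[where x = "[]"]) (auto simp: step_fun_def)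
  have Q: "Q \<subseteq> Lp_class ?C p"
  proof -
    have "step_fun l \<in> Lp_class ?C p" if "l \<in> lists (D \<times> G0)" for l
      using that
    proof (induction l)
      case Nil
      then show ?case by (simp add: step_fun_def Lp_class_def)
    next
      case (Cons a l)
      have "(\<lambda>x. ?ind (snd a) (fst a) x + step_fun l x) \<in> Lp_class ?C p"
        by (rule Lp_class_add) (use p Cons G0(2) ind_L in auto)
      then show ?case by (simp add: step_fun_def case_prod_unfold)
    qed
    then show ?thesis by (auto simp: Q_def)
  qed
  have Qadd: "\<forall>q\<in>Q. \<forall>r\<in>Q. (\<lambda>x. q x + r x) \<in> Q"
  proof (intro ballI)
    fix q r assume "q \<in> Q" "r \<in> Q"
    then obtain l m where "l \<in> lists (D \<times> G0)" "m \<in> lists (D \<times> G0)" "q = step_fun l" "r = step_fun m"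
      by (auto simp: Q_def)
    then show "(\<lambda>x. q x + r x) \<in> Q" unfolding Q_def
      by (intro image_eqI[where x = "l @ m"]) (auto simp: step_fun_append)
  qed
  note p0 = less_imp_le[OF p]
  note add = Lp_closure_add[OF p0 Q Qadd]
  have basic0: "?ind B v \<in> Lp_closure ?C p Q" if B: "B \<in> G0" for B v
  proof (rule Lp_closure_closed[OF p0 Q])
    have BM: "B \<in> sets M" using B G0 by auto
    then show "?ind B v \<in> Lp_class ?C p" by (rule ind_L)
    fix e :: real assume e: "0 < e"
    \<comment> \<open>Replacing \<open>v\<close> by a vector at distance less than \<open>d\<close> costs at most \<open>d\<^sup>p\<close> times the measure of \<open>B\<close>;
      the summand 1 covers the case that \<open>B\<close> is a null set.\<close>
    define d where "d = (e / (measure M B + 1)) powr (1 / p)"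
    have mB: "0 < measure M B + 1" by (simp add: add_nonneg_pos)
    have d: "0 < d" "d powr p = e / (measure M B + 1)"
      using e p mB by (auto simp: d_def powr_powr)
    obtain w where w: "w \<in> D" "w \<in> ball v d" using D(2)[of "ball v d"] d(1) by auto
    have "p_modular ?C p (\<lambda>x. ?ind B v x - ?ind B w x) = norm (v - w) powr p * measure M B"
      using Lp_class_indicator(2)[of B ?C p "v - w"] BM fin_C
      by (simp add: scaleR_diff_right)
    also have "\<dots> \<le> d powr p * measure M B"
      using w p by (intro mult_right_mono powr_mono2) (auto simp: dist_norm)
    also have "\<dots> < d powr p * (measure M B + 1)" using d(1) by simp
    also have "\<dots> = e" using d(2) mB by simp
    finally have "p_modular ?C p (\<lambda>x. ?ind B v x - ?ind B w x) < e" .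
    moreover have "?ind B w \<in> Q" unfolding Q_def
      using w B by (intro image_eqI[where x = "[(w, B)]"]) (auto simp: step_fun_def)
    ultimately show "\<exists>g\<in>Lp_closure ?C p Q. p_modular ?C p (\<lambda>x. ?ind B v x - g x) < e"
      using Lp_closure_superset[OF Q] by (intro bexI[where x = "?ind B w"]) auto
  qed
  have basicG: "?ind A v \<in> Lp_closure ?C p Q" if A: "A \<in> G" for A v
  proof (rule Lp_closure_closed[OF p0 Q])
    have AM: "A \<in> sets M" using A sM by auto
    then show "?ind A v \<in> Lp_class ?C p" by (rule ind_L)
    fix e :: real assume e: "0 < e"
    have nv: "0 < norm v powr p + 1" by (simp add: add_nonneg_pos)
    obtain B where B: "B \<in> G0" "measure M (A - B \<union> (B - A)) < e / (norm v powr p + 1)"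
      using ap[OF A, of "e / (norm v powr p + 1)"] e nv by auto
    have BM: "B \<in> sets M" using B G0 by auto
    have "p_modular ?C p (\<lambda>x. ?ind A v x - ?ind B v x) = p_modular ?C p (?ind (A - B \<union> (B - A)) v)"
      unfolding p_modular_def by (rule arg_cong[where f = "integral\<^sup>L ?C"]) (auto simp: indicator_def fun_eq_iff)
    also have "\<dots> = norm v powr p * measure M (A - B \<union> (B - A))"
      using Lp_class_indicator(2)[of "A - B \<union> (B - A)" ?C p v] AM BM fin_C by simp
    also have "\<dots> \<le> (norm v powr p + 1) * measure M (A - B \<union> (B - A))"
      by (intro mult_right_mono) auto
    also have "\<dots> < e" using B(2) nv by (simp add: field_simps)
    finally show "\<exists>g\<in>Lp_closure ?C p Q. p_modular ?C p (\<lambda>x. ?ind A v x - g x) < e"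
      by (rule bexI[OF _ basic0[OF B(1)]])
  qed
  have sigma: "\<forall>v. ?ind A v \<in> Lp_closure ?C p Q" if "A \<in> sigma_sets (space M) G" for A
    using G(1,2) that
  proof (induction rule: sigma_sets_induct_disjoint)
    case (basic A)
    show ?case using basicG[OF basic] by simp
  next
    case empty
    show ?case using subsetD[OF Lp_closure_superset[OF Q] z] by simp
  next
    case (compl A)
    show ?case
    proof
      fix v
      have "(\<lambda>x. ?ind (space M) v x + ?ind A (- v) x) \<in> Lp_closure ?C p Q"
        using compl basicG[OF G(3)] by (intro add) (simp_all del: scaleR_minus_right)
      moreover have "?ind (space M - A) v = (\<lambda>x. ?ind (space M) v x + ?ind A (- v) x)"
        using compl(1) sets.sets_into_space[of A M] by (auto simp: sM indicator_def fun_eq_iff)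
      ultimately show "?ind (space M - A) v \<in> Lp_closure ?C p Q" by simp
    qed
  next
    case (union A)
    show ?case
    proof
      fix v
      show "?ind (\<Union>i. A i) v \<in> Lp_closure ?C p Q"
      proof (rule Lp_closure_dominated[OF p Q])
        \<comment> \<open>The partial sums are the indicators of the finite unions, dominated by the constant \<open>v\<close>,
          which is p-integrable because the measure is finite.\<close>
        show "(\<lambda>x. \<Sum>i<n. ?ind (A i) v x) \<in> Lp_closure ?C p Q" for n
          using union by (intro Lp_closure_sum[OF p0 Q z Qadd]) auto
        have sum: "(\<Sum>i<n. ?ind (A i) v x) = ?ind (\<Union>i<n. A i) v x" for n x
        proof -
          have "disjoint_family_on A {..<n}"
            by (rule disjoint_family_on_mono[OF subset_UNIV union(1)])
          then have "indicator (\<Union>i<n. A i) x = (\<Sum>i<n. indicator (A i) x :: real)"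
            by (intro indicator_UN_disjoint) auto
          then show ?thesis by (simp only: scaleR_sum_left)
        qed
        show "(\<lambda>n. \<Sum>i<n. ?ind (A i) v x) \<longlonglongrightarrow> ?ind (\<Union>i. A i) v x" for x
          unfolding sum by (intro tendsto_intros LIMSEQ_indicator_UN)
        show "norm (\<Sum>i<n. ?ind (A i) v x) \<le> norm (?ind (space M) v x)" if "x \<in> space ?C" for n x
          using that unfolding sum by (auto simp: indicator_def)
        show "?ind (space M) v \<in> Lp_class ?C p" by (rule ind_L) auto
      qed
    qed
  qed
  have "?ind A v \<in> Lp_closure ?C p Q" if A: "A \<in> sets ?C" for A v
  proof (rule Lp_closure_cong_AE[OF p0 Q])
    show "?ind (main_part M A) v \<in> Lp_closure ?C p Q"
      using sigma main_part_sets[OF A] sM by simp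
    show "?ind A v \<in> borel_measurable ?C" using A by measurable
    show "AE x in ?C. ?ind (main_part M A) v x = ?ind A v x"
      unfolding AE_completion_iff using AE_in_main_part[OF A] by eventually_elim (simp add: indicator_def)
  qed
  then have "Lp_closure ?C p Q = Lp_class ?C p"
    by (rule Lp_closure_eq_Lp_class[OF p Q z Qadd])
  then show ?thesis using cQ Q by blast
qed

text \<open>
  A countable dense family \<open>Q\<close> need not meet the graph of an operator, so density has to be
  transported to a subset \<open>S\<close> of the product: for every pair from \<open>Q\<close> and every tolerance
  \<open>1 / (n + 1)\<close>, pick one element of \<open>S\<close> within that tolerance, if there is any.
\<close>

lemma Lp_class_pairs_separable:
  fixes Q :: "('a \<Rightarrow> 'e::euclidean_space) set" and S :: "(('a \<Rightarrow> 'e) \<times> ('a \<Rightarrow> 'e)) set"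
  assumes p: "0 < p" and Q: "countable Q" "Q \<subseteq> Lp_class M p" "Lp_closure M p Q = Lp_class M p"
    and S: "S \<subseteq> Lp_class M p \<times> Lp_class M p"
  shows "\<exists>S0. countable S0 \<and> S0 \<subseteq> S \<and>
    (\<forall>u g e. (u, g) \<in> S \<longrightarrow> 0 < e \<longrightarrow>
      (\<exists>v h. (v, h) \<in> S0 \<and> p_modular M p (\<lambda>x. u x - v x) + p_modular M p (\<lambda>x. g x - h x) < e))"
proof -
  let ?m = "p_modular M p"
  let ?d = "\<lambda>z q r. ?m (\<lambda>x. fst z x - q x) + ?m (\<lambda>x. snd z x - r x)"
  define near where "near = (\<lambda>(q, r, n) z. z \<in> S \<and> ?d z q r < 1 / real (Suc n))"
  define S0 where "S0 = (\<lambda>i. SOME z. near i z) ` {i \<in> Q \<times> Q \<times> (UNIV :: nat set). \<exists>z. near i z}"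
  have near_S0: "near i (SOME z. near i z)" if "\<exists>z. near i z" for i
    using that by (rule someI_ex)
  have "countable S0"
    unfolding S0_def by (rule countable_image, rule countable_Collect)
      (use Q(1) in auto)
  moreover have "S0 \<subseteq> S"
  proof
    fix z assume "z \<in> S0"
    then obtain i where "\<exists>z. near i z" "z = (SOME z. near i z)" unfolding S0_def by blast
    then have "near i z" using near_S0[of i] by simp
    then show "z \<in> S" by (cases i) (simp add: near_def)
  qed
  moreover have "\<exists>v h. (v, h) \<in> S0 \<and> ?m (\<lambda>x. u x - v x) + ?m (\<lambda>x. g x - h x) < e"
    if ug: "(u, g) \<in> S" and e: "0 < e" for u g e
  proof -
    obtain n where n: "1 / real (Suc n) < e / (2 * 2 powr p)"
      using nat_approx_posE[of "e / (2 * 2 powr p)"] e by auto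
    \<comment> \<open>Two steps of size \<open>d\<close>, to \<open>(q, r)\<close> and on to the chosen element of \<open>S\<close>, stay below \<open>e\<close> after
      the factor \<open>2\<^sup>p\<close> of the triangle inequality.\<close>
    define d where "d = 1 / real (Suc n)"
    have "d * (2 * 2 powr p) < e" using n unfolding d_def by (subst (asm) pos_less_divide_eq) auto
    then have d: "0 < d" "2 powr p * (d + d) < e" by (auto simp: d_def mult_ac)
    have ugL: "u \<in> Lp_class M p" "g \<in> Lp_class M p" using ug S by auto
    have approx: "\<exists>q\<in>Q. ?m (\<lambda>x. f x - q x) < d / 2" if "f \<in> Lp_class M p" for f
    proof -
      have "f \<in> Lp_closure M p Q" using that Q(3) by simp
      then show ?thesis using half_gt_zero[OF d(1)] unfolding Lp_closure_def by blast
    qed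
    obtain q r where q: "q \<in> Q" "?m (\<lambda>x. u x - q x) < d / 2"
      and r: "r \<in> Q" "?m (\<lambda>x. g x - r x) < d / 2"
      using approx[OF ugL(1)] approx[OF ugL(2)] by blast
    have qr: "?m (\<lambda>x. u x - q x) + ?m (\<lambda>x. g x - r x) < d" using q(2) r(2) by simp
    then have ex: "\<exists>z. near (q, r, n) z"
      using ug by (intro exI[where x = "(u, g)"]) (simp add: near_def d_def)
    define z where "z = (SOME z. near (q, r, n) z)"
    have z: "z \<in> S0" using q(1) r(1) ex by (auto simp: S0_def z_def)
    have nz: "near (q, r, n) z" unfolding z_def by (rule near_S0[OF ex])
    obtain v h where vh: "z = (v, h)" by (cases z)
    have vhL: "v \<in> Lp_class M p" "h \<in> Lp_class M p" using nz S by (auto simp: near_def vh)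
    have "?m (\<lambda>x. u x - v x) + ?m (\<lambda>x. g x - h x) \<le>
        2 powr p * (?m (\<lambda>x. u x - q x) + ?m (\<lambda>x. q x - v x)) +
        2 powr p * (?m (\<lambda>x. g x - r x) + ?m (\<lambda>x. r x - h x))"
      by (intro add_mono p_modular_triangle) (use p ugL vhL q r Q(2) in auto)
    also have "\<dots> = 2 powr p * ((?m (\<lambda>x. u x - q x) + ?m (\<lambda>x. g x - r x)) + ?d z q r)"
      by (simp add: vh p_modular_diff_commute[of M p q v] p_modular_diff_commute[of M p r h] algebra_simps)
    also have "\<dots> \<le> 2 powr p * (d + d)"
    proof (intro mult_left_mono add_mono)
      show "?d z q r \<le> d" using nz by (simp add: near_def d_def)
    qed (use qr in auto)
    finally have "?m (\<lambda>x. u x - v x) + ?m (\<lambda>x. g x - h x) < e" using d(2) by linarith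
    then show ?thesis using z unfolding vh by (intro exI[where x = v] exI[where x = h] conjI)
  qed
  ultimately show ?thesis by blast
qed

section \<open>The delta measure\<close>

lemma Lp_delta_eq_Lp_class: "Lp_delta T a b p = Lp_class (delta_measure T a b) p"
  by (simp add: Lp_delta_def Lp_class_def)

text \<open>
  The intervals \<open>[c,d) \<inter> T\<close> with end points in \<open>[a,b] \<inter> T\<close> form a \<open>\<pi>\<close>-system. Moving the end points to \<open>c'\<close>
  and \<open>d'\<close> within \<open>[a,b] \<inter> T\<close> changes the set by at most \<open>|c' - c| + |d' - d|\<close> in measure, even where
  points of \<open>T\<close> are isolated, because the measure of an interval is the distance of its end points.
  Therefore end points from a countable dense subset of \<open>[a,b] \<inter> T\<close> suffice.
\<close>

lemma Lp_delta_separable: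
  assumes T: "closed T" and ab: "a \<in> T" "b \<in> T" "a < b" and p: "0 < p"
  shows "\<exists>Q :: (real \<Rightarrow> 'e::euclidean_space) set. countable Q \<and> Q \<subseteq> Lp_delta T a b p \<and>
    Lp_closure (delta_measure T a b) p Q = Lp_delta T a b p"
proof -
  define I where "I = {(c, d). c \<in> tsJ T a b \<and> d \<in> tsJ T a b \<and> c \<le> d}"
  define M where "M = extend_measure (tsJ0 T a b) I (\<lambda>(c, d). {c..<d} \<inter> T) (\<lambda>(c, d). ennreal (d - c))"
  define G where "G = (\<lambda>(c, d). {c..<d} \<inter> T) ` I"
  have C: "delta_measure T a b = completion M" by (simp add: delta_measure_def M_def I_def)
  have GP: "G \<subseteq> Pow (tsJ0 T a b)" unfolding G_def I_def by auto
  then have sM: "sets M = sigma_sets (tsJ0 T a b) G" and spM: "space M = tsJ0 T a b"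
    unfolding M_def G_def by (simp_all add: sets_extend_measure space_extend_measure)
  have G_interval: "{c..<d} \<inter> T \<in> G" if "c \<in> tsJ T a b" "d \<in> tsJ T a b" for c d
  proof (cases "c \<le> d")
    case True
    then show ?thesis using that by (auto simp: G_def I_def)
  next
    case False
    then have "{c..<d} \<inter> T = {c..<c} \<inter> T" by auto
    then show ?thesis using that by (auto simp: G_def I_def intro!: image_eqI[where x = "(c, c)"])
  qed
  have G_sets: "A \<in> sets M" if "A \<in> G" for A using that sM by auto
  have em: "emeasure M ({c..<d} \<inter> T) = ennreal (d - c)" if "c \<in> tsJ T a b" "d \<in> tsJ T a b" "c \<le> d" for c d
    using emeasure_delta_measure[OF T ab that] G_sets[OF G_interval[OF that(1,2)]] by (simp add: C)
  have em_le: "measure M ({min c d..<max c d} \<inter> T) \<le> \<bar>d - c\<bar>" if "c \<in> tsJ T a b" "d \<in> tsJ T a b" for c d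
    using em[of c d] em[of d c] that by (cases "c \<le> d") (auto simp: measure_def)
  have ab_J: "a \<in> tsJ T a b" "b \<in> tsJ T a b" using ab by auto
  have fin: "finite_measure M"
    using em[OF ab_J] ab(3) by (intro finite_measureI) (simp add: spM)
  interpret finite_measure M by (rule fin)
  obtain D where D: "countable D" "D \<subseteq> tsJ T a b" "tsJ T a b \<subseteq> closure D"
    by (rule separable)
  define G0 where "G0 = (\<lambda>(c, d). {c..<d} \<inter> T) ` (D \<times> D)"
  have "\<exists>Q :: (real \<Rightarrow> 'e) set. countable Q \<and> Q \<subseteq> Lp_class (completion M) p \<and>
    Lp_closure (completion M) p Q = Lp_class (completion M) p"
  proof (rule Lp_class_separable[OF p fin])
    show "Int_stable G"
    proof (rule Int_stableI)
      fix A B assume "A \<in> G" "B \<in> G"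
      then obtain c d c' d' where *: "A = {c..<d} \<inter> T" "B = {c'..<d'} \<inter> T"
        "c \<in> tsJ T a b" "d \<in> tsJ T a b" "c' \<in> tsJ T a b" "d' \<in> tsJ T a b"
        by (auto simp: G_def I_def)
      have "A \<inter> B = {max c c'..<min d d'} \<inter> T" using * by auto
      also have "\<dots> \<in> G" using * by (intro G_interval) (auto simp: max_def min_def)
      finally show "A \<inter> B \<in> G" .
    qed
    show "G \<subseteq> Pow (space M)" "sets M = sigma_sets (space M) G" using GP sM spM by auto
    show "space M \<in> G" using G_interval[OF ab_J] by (simp add: spM)
    show "countable G0" unfolding G0_def using D(1) by auto
    show "G0 \<subseteq> sets M" using D(2) by (auto simp: G0_def intro!: G_sets G_interval)
    fix A and e :: real assume "A \<in> G" and e: "0 < e"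
    then obtain c d where A: "A = {c..<d} \<inter> T" and cd: "c \<in> tsJ T a b" "d \<in> tsJ T a b"
      by (auto simp: G_def I_def)
    have "\<exists>x'\<in>D. dist x' x < e / 2" if "x \<in> tsJ T a b" for x
      using subsetD[OF D(3) that] half_gt_zero[OF e] unfolding closure_approachable by blast
    then obtain c' d' where D': "c' \<in> D" "\<bar>c' - c\<bar> < e / 2" "d' \<in> D" "\<bar>d' - d\<bar> < e / 2"
      using cd unfolding dist_real_def by blast
    have cd': "c' \<in> tsJ T a b" "d' \<in> tsJ T a b" using D' D(2) by auto
    let ?B = "{c'..<d'} \<inter> T"
    \<comment> \<open>Where exactly one of the two intervals contains a point, that point lies between the two left
      or between the two right end points.\<close>
    let ?C = "{min c c'..<max c c'} \<inter> T" and ?D = "{min d d'..<max d d'} \<inter> T"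
    have CD: "?C \<in> sets M" "?D \<in> sets M"
      using cd cd' by (auto intro!: G_sets G_interval simp: min_def max_def)
    have "measure M (A - ?B \<union> (?B - A)) \<le> measure M (?C \<union> ?D)"
      by (rule finite_measure_mono) (use CD A in \<open>auto simp: min_def max_def\<close>)
    also have "\<dots> \<le> measure M ?C + measure M ?D"
      by (rule measure_Un_le[OF CD])
    also have "\<dots> \<le> \<bar>c' - c\<bar> + \<bar>d' - d\<bar>"
      by (intro add_mono em_le cd cd')
    also have "\<dots> < e" using D' by simp
    finally have "measure M (A - ?B \<union> (?B - A)) < e" .
    moreover have "?B \<in> G0" using D' by (auto simp: G0_def)
    ultimately show "\<exists>B\<in>G0. measure M (A - B \<union> (B - A)) < e" by blast
  qed
  then show ?thesis by (simp add: C Lp_delta_eq_Lp_class)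
qed

text \<open>
  A Riemann-Liouville derivative is known only almost everywhere; completeness of the delta measure is
  what makes it measurable nevertheless.
\<close>

lemma borel_measurable_delta_cong_AE:
  assumes f: "f \<in> borel_measurable (delta_measure T a b)"
    and ae: "AE t in delta_measure T a b. f t = g t"
  shows "g \<in> borel_measurable (delta_measure T a b)"
proof (rule borel_measurableI)
  interpret complete_measure "delta_measure T a b"
    unfolding delta_measure_def by (rule completion.complete_measure_axioms)
  fix S :: "'a set" assume "open S"
  then have "f -` S \<inter> space (delta_measure T a b) \<in> sets (delta_measure T a b)"
    using f by (auto intro: measurable_sets)
  moreover have "AE t in delta_measure T a b.
      t \<in> f -` S \<inter> space (delta_measure T a b) \<longleftrightarrow> t \<in> g -` S \<inter> space (delta_measure T a b)"
    using ae by eventually_elim simp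
  ultimately show "g -` S \<inter> space (delta_measure T a b) \<in> sets (delta_measure T a b)"
    using in_sets_AE by blast
qed

section \<open>Linearity of the derivatives\<close>

lemma fjump_mem:
  assumes "compact K" "K \<noteq> {}"
  shows "fjump K t \<in> K"
proof (cases "\<exists>s\<in>K. s > t")
  case True
  have "Inf {s\<in>K. s > t} \<in> closure {s\<in>K. s > t}"
    using True by (intro closure_contains_Inf) (auto intro: bdd_belowI[where m = t])
  also have "\<dots> \<subseteq> K" using assms by (intro closure_minimal) (auto simp: compact_imp_closed)
  finally show ?thesis using True by (simp add: fjump_def)
next
  case False
  then show ?thesis using closed_contains_Sup[of K] assms
    by (auto simp: fjump_def compact_imp_closed bounded_imp_bdd_above compact_imp_bounded)
qed

text \<open>
  Only a point \<open>s\<close> other than \<open>\<sigma>(t)\<close> says anything about the delta derivative at \<open>t\<close>. If \<open>t\<close> is right-dense,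
  such points lie to the right of \<open>t\<close>; if \<open>t\<close> is right-scattered, \<open>t\<close> itself is one.
\<close>

lemma ex_near_not_fjump:
  assumes t: "t \<in> K" and later: "\<exists>s\<in>K. t < s" and d: "0 < d"
  shows "\<exists>s\<in>K. \<bar>s - t\<bar> < d \<and> s \<noteq> fjump K t"
proof (cases "fjump K t = t")
  case True
  then have "Inf {s\<in>K. s > t} < t + d" using later d by (simp add: fjump_def)
  moreover have "bdd_below {s\<in>K. s > t}" by (rule bdd_belowI[where m = t]) auto
  ultimately obtain s where "s \<in> K" "t < s" "s < t + d"
    using later cInf_less_iff[of "{s\<in>K. s > t}" "t + d"] by auto
  then show ?thesis using True by (intro bexI[where x = s]) auto
next
  case False
  then show ?thesis using t d by (intro bexI[where x = t]) auto
qed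

lemma has_delta_deriv_unique:
  assumes c: "has_delta_deriv K f c t" and c': "has_delta_deriv K f c' t"
    and t: "t \<in> K" and later: "\<exists>s\<in>K. t < s"
  shows "c = c'"
proof (rule ccontr)
  assume ne: "c \<noteq> c'"
  \<comment> \<open>The two difference estimates at \<open>s\<close> add up to \<open>2 e |\<sigma>(t) - s|\<close>, half of what \<open>c - c'\<close> would require.\<close>
  define e where "e = norm (c - c') / 4"
  have e: "0 < e" using ne by (simp add: e_def)
  let ?\<sigma> = "fjump K t"
  obtain d where d: "0 < d" "\<And>s. s \<in> K \<Longrightarrow> \<bar>s - t\<bar> < d \<Longrightarrow>
      norm (f ?\<sigma> - f s - (?\<sigma> - s) *\<^sub>R c) \<le> e * \<bar>?\<sigma> - s\<bar>"
    using c e unfolding has_delta_deriv_def by blast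
  obtain d' where d': "0 < d'" "\<And>s. s \<in> K \<Longrightarrow> \<bar>s - t\<bar> < d' \<Longrightarrow>
      norm (f ?\<sigma> - f s - (?\<sigma> - s) *\<^sub>R c') \<le> e * \<bar>?\<sigma> - s\<bar>"
    using c' e unfolding has_delta_deriv_def by blast
  obtain s where s: "s \<in> K" "\<bar>s - t\<bar> < min d d'" "s \<noteq> ?\<sigma>"
    using ex_near_not_fjump[OF t later, of "min d d'"] d(1) d'(1) by auto
  have "\<bar>?\<sigma> - s\<bar> * norm (c - c') =
      norm ((f ?\<sigma> - f s - (?\<sigma> - s) *\<^sub>R c') - (f ?\<sigma> - f s - (?\<sigma> - s) *\<^sub>R c))"
    by (simp add: norm_scaleR[symmetric] scaleR_diff_right del: norm_scaleR)
  also have "\<dots> \<le> e * \<bar>?\<sigma> - s\<bar> + e * \<bar>?\<sigma> - s\<bar>"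
    by (rule order_trans[OF norm_triangle_ineq4 add_mono]) (use d(2) d'(2) s in auto)
  also have "\<dots> = \<bar>?\<sigma> - s\<bar> * (norm (c - c') / 2)" by (simp add: e_def)
  finally show False using s(3) ne by (simp add: mult_le_cancel_left)
qed

lemma delta_deriv_eqI:
  assumes "has_delta_deriv K f c t" "t \<in> K" "\<exists>s\<in>K. t < s"
  shows "delta_deriv K f t = c"
  unfolding delta_deriv_def
  by (rule some_equality) (use assms has_delta_deriv_unique in blast)+

lemma has_delta_deriv_diff:
  assumes f: "has_delta_deriv K f c t" and g: "has_delta_deriv K g c' t"
  shows "has_delta_deriv K (\<lambda>s. f s - g s) (c - c') t"
  unfolding has_delta_deriv_def
proof (intro allI impI)
  fix e :: real assume "0 < e"
  then have e: "0 < e / 2" by simp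
  let ?\<sigma> = "fjump K t"
  obtain d where d: "0 < d" "\<And>s. s \<in> K \<Longrightarrow> \<bar>s - t\<bar> < d \<Longrightarrow>
      norm (f ?\<sigma> - f s - (?\<sigma> - s) *\<^sub>R c) \<le> e / 2 * \<bar>?\<sigma> - s\<bar>"
    using f e unfolding has_delta_deriv_def by blast
  obtain d' where d': "0 < d'" "\<And>s. s \<in> K \<Longrightarrow> \<bar>s - t\<bar> < d' \<Longrightarrow>
      norm (g ?\<sigma> - g s - (?\<sigma> - s) *\<^sub>R c') \<le> e / 2 * \<bar>?\<sigma> - s\<bar>"
    using g e unfolding has_delta_deriv_def by blast
  have "norm (f ?\<sigma> - g ?\<sigma> - (f s - g s) - (?\<sigma> - s) *\<^sub>R (c - c')) \<le> e * \<bar>?\<sigma> - s\<bar>"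
    if s: "s \<in> K" "\<bar>s - t\<bar> < min d d'" for s
  proof -
    have "norm (f ?\<sigma> - g ?\<sigma> - (f s - g s) - (?\<sigma> - s) *\<^sub>R (c - c')) =
        norm ((f ?\<sigma> - f s - (?\<sigma> - s) *\<^sub>R c) - (g ?\<sigma> - g s - (?\<sigma> - s) *\<^sub>R c'))"
      by (simp add: scaleR_diff_right algebra_simps)
    also have "\<dots> \<le> e / 2 * \<bar>?\<sigma> - s\<bar> + e / 2 * \<bar>?\<sigma> - s\<bar>"
      by (rule order_trans[OF norm_triangle_ineq4 add_mono]) (use d(2) d'(2) s in auto)
    finally show ?thesis by simp
  qed
  then show "\<exists>d>0. \<forall>s\<in>K. \<bar>s - t\<bar> < d \<longrightarrow>
      norm (f ?\<sigma> - g ?\<sigma> - (f s - g s) - (?\<sigma> - s) *\<^sub>R (c - c')) \<le> e * \<bar>?\<sigma> - s\<bar>"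
    using d(1) d'(1) by (intro exI[where x = "min d d'"]) auto
qed

lemma has_delta_deriv_cong:
  assumes "\<And>s. s \<in> K \<Longrightarrow> f s = g s" "fjump K t \<in> K"
  shows "has_delta_deriv K f c t \<longleftrightarrow> has_delta_deriv K g c t"
  using assms by (simp add: has_delta_deriv_def)

text \<open>
  The integrability required by \<open>has_RL_left\<close> makes the fractional integral additive at every point of
  \<open>[a,b] \<inter> T\<close>, and the delta derivative sees only these points. Each \<open>t < b\<close> has a later point in the
  time scale, namely \<open>b\<close>, so derivatives are unique almost everywhere and \<open>RL_left\<close> picks them.
\<close>

lemma RL_left_diff:
  assumes T: "closed T" and ab: "a \<in> T" "b \<in> T" "a < b" and \<alpha>: "\<alpha> \<le> 1"
    and u: "has_RL_left T a b \<alpha> u" and w: "has_RL_left T a b \<alpha> w"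
  shows "has_RL_left T a b \<alpha> (\<lambda>t. u t - w t)"
    and "AE t in delta_measure T a b.
      RL_left T a b \<alpha> u t - RL_left T a b \<alpha> w t = RL_left T a b \<alpha> (\<lambda>t. u t - w t) t"
proof -
  let ?J = "tsJ T a b" and ?d = "\<lambda>t. u t - w t" and ?I = "frac_int_left T a b (1 - \<alpha>)"
  let ?k = "\<lambda>h t s. ((t - fjump T s) powr (- \<alpha>)) *\<^sub>R h s"
  have jump: "fjump ?J t \<in> ?J" for t
  proof (rule fjump_mem)
    show "compact ?J" using T by (simp add: compact_Int_closed)
    have "a \<in> ?J" using ab by simp
    then show "?J \<noteq> {}" by blast
  qed
  have int: "set_integrable (delta_measure T a b) ({a..<t} \<inter> T) (?k u t)"
    "set_integrable (delta_measure T a b) ({a..<t} \<inter> T) (?k w t)"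
    if "\<alpha> < 1" "t \<in> ?J" for t
    using that u w by (auto simp: has_RL_left_def)
  have kdiff: "?k ?d t = (\<lambda>s. ?k u t s - ?k w t s)" for t by (simp add: scaleR_diff_right)
  have I_diff: "?I ?d t = ?I u t - ?I w t" if t: "t \<in> ?J" for t
  proof (cases "\<alpha> = 1")
    case True
    then show ?thesis by (simp add: frac_int_left_def)
  next
    case False
    then have "\<alpha> < 1" using \<alpha> by simp
    with set_integral_diff(2)[OF int[OF this t]] show ?thesis
      by (simp add: frac_int_left_def scaleR_diff_right kdiff)
  qed
  have deriv: "has_delta_deriv ?J (?I ?d) (c - c') t"
    if "has_delta_deriv ?J (?I u) c t" "has_delta_deriv ?J (?I w) c' t" for c c' t
    by (rule iffD2[OF has_delta_deriv_cong[OF _ jump] has_delta_deriv_diff[OF that]]) (rule I_diff)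
  have ae: "AE t in delta_measure T a b. t \<in> tsJ0 T a b \<and>
      (\<exists>c. has_delta_deriv ?J (?I u) c t) \<and> (\<exists>c. has_delta_deriv ?J (?I w) c t)"
  proof -
    have "space (delta_measure T a b) = tsJ0 T a b"
      unfolding delta_measure_def by (simp, subst space_extend_measure) auto
    then show ?thesis using u w AE_space[of "delta_measure T a b"]
      by (auto simp: has_RL_left_def)
  qed
  have "AE t in delta_measure T a b. \<exists>c. has_delta_deriv ?J (?I ?d) c t"
    using ae by eventually_elim (use deriv in blast)
  then show "has_RL_left T a b \<alpha> ?d"
    unfolding has_RL_left_def kdiff using set_integral_diff(1)[OF int] by auto
  show "AE t in delta_measure T a b.
      RL_left T a b \<alpha> u t - RL_left T a b \<alpha> w t = RL_left T a b \<alpha> ?d t"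
    using ae
  proof eventually_elim
    case (elim t)
    then obtain c c' where c: "has_delta_deriv ?J (?I u) c t" "has_delta_deriv ?J (?I w) c' t" by auto
    have t: "t \<in> ?J" "\<exists>s\<in>?J. t < s" using elim ab by auto
    show ?case
      unfolding RL_left_def delta_deriv_eqI[OF c(1) t] delta_deriv_eqI[OF c(2) t]
        delta_deriv_eqI[OF deriv[OF c] t] ..
  qed
qed

lemma weak_left_deriv_add:
  assumes "weak_left_deriv T a b \<alpha> u g" "weak_left_deriv T a b \<alpha> v h"
  shows "weak_left_deriv T a b \<alpha> (\<lambda>t. u t + v t) (\<lambda>t. g t + h t)"
  using assms by (simp add: weak_left_deriv_def inner_add_left)

lemma weak_left_deriv_uminus:
  assumes "weak_left_deriv T a b \<alpha> u g"
  shows "weak_left_deriv T a b \<alpha> (\<lambda>t. - u t) (\<lambda>t. - g t)"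
  using assms by (simp add: weak_left_deriv_def)

lemma weak_left_deriv_diff:
  assumes "weak_left_deriv T a b \<alpha> u g" "weak_left_deriv T a b \<alpha> v h"
  shows "weak_left_deriv T a b \<alpha> (\<lambda>t. u t - v t) (\<lambda>t. g t - h t)"
  using weak_left_deriv_add[OF assms(1) weak_left_deriv_uminus[OF assms(2)]] by simp

lemma W_space_add:
  assumes p: "0 \<le> p" and u: "u \<in> W_space T a b \<alpha> p" and v: "v \<in> W_space T a b \<alpha> p"
  shows "(\<lambda>t. u t + v t) \<in> W_space T a b \<alpha> p"
proof -
  from u v obtain g h where "g \<in> Lp_delta T a b p" "weak_left_deriv T a b \<alpha> u g"
    "h \<in> Lp_delta T a b p" "weak_left_deriv T a b \<alpha> v h" by (auto simp: W_space_def)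
  with u v show ?thesis
    by (auto simp: W_space_def Lp_delta_eq_Lp_class
        intro!: Lp_class_add[OF p] bexI[where x = "\<lambda>t. g t + h t"] weak_left_deriv_add)
qed

section \<open>Density in the Sobolev norm\<close>

lemma W_norm_lessI:
  assumes p: "0 < p" and e: "0 < e" and h: "h \<in> left_derivs T a b \<alpha> p u"
    and less: "p_modular (delta_measure T a b) p u + p_modular (delta_measure T a b) p h < e powr p"
  shows "W_norm T a b \<alpha> p u < e"
proof -
  let ?m = "p_modular (delta_measure T a b) p"
  have norm: "Lp_delta_norm T a b p f powr p = ?m f" for f :: "real \<Rightarrow> 'a"
    using p p_modular_nonneg[of "delta_measure T a b" p f]
    by (simp add: Lp_delta_norm_def p_modular_def powr_powr)
  have "W_norm T a b \<alpha> p u \<le> (?m u + ?m h) powr (1 / p)"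
    unfolding W_norm_def norm by (rule cINF_lower[OF bdd_belowI2[where m = 0] h]) simp
  also have "\<dots> < (e powr p) powr (1 / p)"
    using p less by (intro powr_less_mono2) (auto simp: p_modular_nonneg)
  also have "\<dots> = e" using p e by (simp add: powr_powr)
  finally show ?thesis .
qed

theorem theorem4p8:
  fixes T :: "real set" and a b \<alpha> p :: real
  assumes "closed T" and "a \<in> T" and "b \<in> T" and "0 < a" and "a < b"
    and "0 < \<alpha>" and "\<alpha> \<le> 1" and "1 \<le> p"
  shows "separable_wrt (W_norm T a b \<alpha> p)
           (W_space T a b \<alpha> p :: (real \<Rightarrow> real ^ 'n) set)"
proof -
  let ?L = "Lp_delta T a b p :: (real \<Rightarrow> real ^ 'n) set"
  let ?W = "W_space T a b \<alpha> p :: (real \<Rightarrow> real ^ 'n) set"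
  let ?R = "RL_left T a b \<alpha> :: (real \<Rightarrow> real ^ 'n) \<Rightarrow> real \<Rightarrow> real ^ 'n"
  let ?m = "p_modular (delta_measure T a b) p :: (real \<Rightarrow> real ^ 'n) \<Rightarrow> real"
  have p: "0 < p" using assms(8) by simp
  \<comment> \<open>The functions for which the norm uses the Riemann-Liouville derivative.\<close>
  define classical where "classical u \<longleftrightarrow> has_RL_left T a b \<alpha> u \<and> ?R u \<in> ?L" for u
  note RL_diff = RL_left_diff[OF assms(1-3,5,7)]
  have classical_diff: "classical (\<lambda>t. u t - w t) \<and> ?m (?R (\<lambda>t. u t - w t)) = ?m (\<lambda>t. ?R u t - ?R w t)"
    if "classical u" "classical w" for u w
  proof -
    have u: "has_RL_left T a b \<alpha> u" "?R u \<in> ?L" and w: "has_RL_left T a b \<alpha> w" "?R w \<in> ?L"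
      using that by (auto simp: classical_def)
    have dL: "(\<lambda>t. ?R u t - ?R w t) \<in> ?L"
      using u w p unfolding Lp_delta_eq_Lp_class by (intro Lp_class_diff) auto
    then have dm: "(\<lambda>t. ?R u t - ?R w t) \<in> borel_measurable (delta_measure T a b)"
      by (simp add: Lp_delta_def)
    note ae = RL_diff(2)[OF u(1) w(1)]
    note Rm = borel_measurable_delta_cong_AE[OF dm ae]
    have "?R (\<lambda>t. u t - w t) \<in> ?L"
      using Lp_class_cong_AE[OF _ Rm ae] dL by (simp add: Lp_delta_eq_Lp_class)
    then show ?thesis
      using RL_diff(1)[OF u(1) w(1)] p_modular_cong_AE[OF dm Rm ae] by (simp add: classical_def)
  qed
  obtain D :: "(real \<Rightarrow> real ^ 'n) set" where D: "countable D" "D \<subseteq> ?L"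
      "Lp_closure (delta_measure T a b) p D = ?L"
    using Lp_delta_separable[OF assms(1-3,5) p] by blast
  define weak where "weak = {(u, g). u \<in> ?L \<and> g \<in> ?L \<and> weak_left_deriv T a b \<alpha> u g}"
  define strong where "strong = (\<lambda>u. (u, ?R u)) ` {u \<in> ?W. classical u}"
  note pairs = Lp_class_pairs_separable[OF p D[unfolded Lp_delta_eq_Lp_class]]
  obtain A where A: "countable A" "A \<subseteq> weak"
    "\<And>u g e. (u, g) \<in> weak \<Longrightarrow> 0 < e \<Longrightarrow>
      \<exists>v h. (v, h) \<in> A \<and> ?m (\<lambda>x. u x - v x) + ?m (\<lambda>x. g x - h x) < e"
    using pairs[of weak] unfolding weak_def Lp_delta_eq_Lp_class by blast
  have "strong \<subseteq> ?L \<times> ?L" by (auto simp: strong_def W_space_def classical_def)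
  then obtain B where B: "countable B" "B \<subseteq> strong"
    "\<And>u g e. (u, g) \<in> strong \<Longrightarrow> 0 < e \<Longrightarrow>
      \<exists>v h. (v, h) \<in> B \<and> ?m (\<lambda>x. u x - v x) + ?m (\<lambda>x. g x - h x) < e"
    using pairs[of strong] unfolding Lp_delta_eq_Lp_class by blast
  define Q where "Q = fst ` A \<union> (\<lambda>(y, z) t. fst y t + fst z t) ` (A \<times> B)"
  have fst_A: "fst y \<in> ?W" if "y \<in> A" for y using that A(2) by (cases y) (auto simp: weak_def W_space_def)
  have fst_B: "fst z \<in> ?W" if "z \<in> B" for z using that B(2) by (auto simp: strong_def)
  have "countable Q" unfolding Q_def using A(1) B(1) by auto
  moreover have "Q \<subseteq> ?W"
    unfolding Q_def using fst_A W_space_add[OF less_imp_le[OF p] fst_A fst_B] by auto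
  moreover have "\<exists>q\<in>Q. W_norm T a b \<alpha> p (\<lambda>t. u t - q t) < e" if u: "u \<in> ?W" and e: "0 < e" for u e
  proof -
    obtain g where g: "(u, g) \<in> weak" using u by (auto simp: weak_def W_space_def)
    have ep: "0 < e powr p" using e by simp
    obtain v h where vh: "(v, h) \<in> A" "?m (\<lambda>x. u x - v x) + ?m (\<lambda>x. g x - h x) < e powr p"
      using A(3)[OF g ep] by blast
    have vhw: "(v, h) \<in> weak" using vh A(2) by auto
    have dL: "(\<lambda>t. u t - v t) \<in> ?L" "(\<lambda>t. g t - h t) \<in> ?L"
      using g vhw p unfolding weak_def Lp_delta_eq_Lp_class by (auto intro: Lp_class_diff)
    have dw: "weak_left_deriv T a b \<alpha> (\<lambda>t. u t - v t) (\<lambda>t. g t - h t)"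
      using g vhw unfolding weak_def by (auto intro: weak_left_deriv_diff)
    show ?thesis
    proof (cases "classical (\<lambda>t. u t - v t)")
      case False
      then have "(\<lambda>t. g t - h t) \<in> left_derivs T a b \<alpha> p (\<lambda>t. u t - v t)"
        using dL(2) dw by (auto simp: left_derivs_def classical_def)
      from W_norm_lessI[OF p e this vh(2)] have "W_norm T a b \<alpha> p (\<lambda>t. u t - v t) < e" .
      moreover have "v \<in> Q" using vh(1) by (force simp: Q_def)
      ultimately show ?thesis by blast
    next
      case True
      have "(\<lambda>t. u t - v t) \<in> ?W" using dL dw by (auto simp: W_space_def)
      with True have "((\<lambda>t. u t - v t), ?R (\<lambda>t. u t - v t)) \<in> strong" by (auto simp: strong_def)
      from B(3)[OF this ep] obtain w k where wk: "(w, k) \<in> B"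
        "?m (\<lambda>t. u t - v t - w t) + ?m (\<lambda>t. ?R (\<lambda>t. u t - v t) t - k t) < e powr p" by blast
      have w: "classical w" "k = ?R w" using wk(1) B(2) by (auto simp: strong_def)
      \<comment> \<open>Being a difference of classical functions, \<open>?d\<close> is classical, so its norm is the one that was
        made small in the choice of \<open>w\<close>.\<close>
      let ?d = "\<lambda>t. u t - v t - w t"
      have d: "classical ?d" "?m (?R ?d) = ?m (\<lambda>t. ?R (\<lambda>t. u t - v t) t - ?R w t)"
        using classical_diff[OF True w(1)] by auto
      have "?R ?d \<in> left_derivs T a b \<alpha> p ?d"
        using d(1) by (simp add: left_derivs_def classical_def)
      from W_norm_lessI[OF p e this] have "W_norm T a b \<alpha> p ?d < e" using wk(2) d(2) w(2) by simp
      moreover have "(\<lambda>t. v t + w t) \<in> Q" unfolding Q_def using vh(1) wk(1)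
        by (intro UnI2 image_eqI[where x = "((v, h), (w, k))"]) auto
      ultimately show ?thesis by (intro bexI[where x = "\<lambda>t. v t + w t"]) (auto simp: diff_diff_eq)
    qed
  qed
  ultimately show ?thesis unfolding separable_wrt_def by blast
qed

end
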